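(* Let $\mathrm{d}$ be a diffuse Fredholm-nilpotent operator on a real Hilbert space $W$ with dense domain $V$, and let $V_h\subset V$ be a family of closed subspaces, parametrized by $h$, with $\mathrm{d}V_h\subset V_h$, equipped with projections $\pi_h$ onto $V_h$ that are defined and bounded on $W$, uniformly in $h$, and satisfy $\pi_h\mathrm{d}=\mathrm{d}\pi_h$ on $V$. Then there is a constant $C>0$, independent of $h$ and $f$, such that for every $f\in W$ and every $h$: if $(u,p)\in V\times\mathfrak{H}$ solves $$\langle \mathrm{d}u,v\rangle+\langle u,\mathrm{d}v\rangle+\langle p,v\rangle=\langle f,v\rangle\ \ \forall v\in V,\qquad \langle u,q\rangle=0\ \ \forall q\in\mathfrak{H},$$ and $(u_h,p_h)\in V_h\times\mathfrak{H}_h$ solves $$\langle \mathrm{d}u_h,v_h\rangle+\langle u_h,\mathrm{d}v_h\rangle+\langle p_h,v_h\rangle=\langle f,v_h\rangle\ \ \forall v_h\in V_h,\qquad \langle u_h,q_h\rangle=0\ \ \forall q_h\in\mathfrak{H}_h,$$ then $$\|P_{\mathfrak{B}^\ast}u-P_{\mathfrak{B}_h^\ast}u_h\|\le C\bigl[E(P_{\mathfrak{B}^\ast}u)+\eta\,E(\mathrm{d}u)\bigr],$$ where $\eta=\|(I-\pi_h)K\|$.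
   Context: $W$ has inner product $\langle\cdot,\cdot\rangle$ and norm $\|\cdot\|$. A closed, densely defined linear operator $\mathrm{d}$ on $W$ with domain $V=\mathcal{D}(\mathrm{d})$ is nilpotent if its range is contained in its kernel (so $\mathrm{d}^2=0$); it is diffuse Fredholm-nilpotent if in addition its range is closed, its range has finite codimension in its kernel, and $\mathcal{D}(\mathrm{d})\cap\ker(\mathrm{d})^\perp$ (with the graph norm) is compactly included in $\ker(\mathrm{d})^\perp$. $V$ carries the graph inner product $\langle u,v\rangle_V=\langle u,v\rangle+\langle \mathrm{d}u,\mathrm{d}v\rangle$. Set $\mathfrak{Z}=\ker\mathrm{d}$, $\mathfrak{B}=\operatorname{range}\mathrm{d}$, $\mathfrak{H}=\mathfrak{Z}\cap\mathfrak{B}^{\perp_W}$, where $\perp_W$ is the orthogonal complement in $W$; $\mathfrak{B}^\ast$ is the range of the adjoint $\mathrm{d}^\ast$, and $\mathfrak{B}^\ast=\mathfrak{Z}^{\perp_W}$. "Projection $\pi_h$ onto $V_h$" means linear, idempotent, with range $V_h$ (not necessarily orthogonal). For $\mathrm{d}_h=\mathrm{d}|_{V_h}$ put $\mathfrak{Z}_h=\ker\mathrm{d}_h$, $\mathfrak{B}_h=\mathrm{d}V_h$, $\mathfrak{H}_h=\{z\in\mathfrak{Z}_h:\langle z,b\rangle=0\ \forall b\in\mathfrak{B}_h\}$; $\mathfrak{B}_h^\ast$ is the range of the adjoint $\mathrm{d}_h^\ast$ of $\mathrm{d}_h\colon V_h\to V_h$ with respect to the $W$-inner product, and $\mathfrak{B}_h^\ast=\{v\in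 V_h:\langle v,z\rangle=0\ \forall z\in\mathfrak{Z}_h\}$. $P_X$ denotes $W$-orthogonal projection onto a closed subspace $X$. $K\colon W\to W$ is the solution operator $f\mapsto u$, where $(u,p)\in V\times\mathfrak{H}$ is the unique solution of the first (continuous) variational problem in the claim with right-hand side $f$. $\eta$ (which depends on $h$) is an operator norm on $W$. For $w\in W$, $E(w)=\inf_{v_h\in V_h}\|w-v_h\|$. *)

theory Defs
  imports "HOL-Analysis.Analysis"
begin

text \<open>
  A real Hilbert space is a type of sort \<open>{real_inner, complete_space}\<close>.  A linear operator with
  domain \<open>V\<close> is represented by \<open>V\<close> together with a total function \<open>d\<close>, whose values outside \<open>V\<close>
  are irrelevant; its restriction to a subspace \<open>U \<subseteq> V\<close> is thus the same function with domain \<open>U\<close>.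
\<close>

definition linear_operator_on :: "'a::real_vector set \<Rightarrow> ('a \<Rightarrow> 'a) \<Rightarrow> bool" where
  "linear_operator_on V d \<longleftrightarrow> subspace V \<and>
     (\<forall>u\<in>V. \<forall>v\<in>V. d (u + v) = d u + d v) \<and> (\<forall>c. \<forall>u\<in>V. d (c *\<^sub>R u) = c *\<^sub>R d u)"

definition densely_defined :: "'a::real_inner set \<Rightarrow> bool" where
  "densely_defined V \<longleftrightarrow> closure V = UNIV"

definition closed_operator_on :: "'a::real_inner set \<Rightarrow> ('a \<Rightarrow> 'a) \<Rightarrow> bool" where
  "closed_operator_on V d \<longleftrightarrow> closed ((\<lambda>u. (u, d u)) ` V)"

definition kernel_on :: "'a::real_vector set \<Rightarrow> ('a \<Rightarrow> 'a) \<Rightarrow> 'a set" where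
  "kernel_on V d = {u \<in> V. d u = 0}"

definition harmonic :: "'a::real_inner set \<Rightarrow> ('a \<Rightarrow> 'a) \<Rightarrow> 'a set" where
  "harmonic V d = kernel_on V d \<inter> (d ` V)\<^sup>\<bottom>"

definition nilpotent_operator :: "'a::real_inner set \<Rightarrow> ('a \<Rightarrow> 'a) \<Rightarrow> bool" where
  "nilpotent_operator V d \<longleftrightarrow> linear_operator_on V d \<and> densely_defined V \<and>
     closed_operator_on V d \<and> d ` V \<subseteq> kernel_on V d"

text \<open>For subspaces \<open>B \<subseteq> Z\<close>: the quotient \<open>Z / B\<close> is spanned by finitely many cosets \<open>s + B\<close>.\<close>

definition finite_codim_in :: "'a::real_vector set \<Rightarrow> 'a set \<Rightarrow> bool" where
  "finite_codim_in B Z \<longleftrightarrow>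
     (\<exists>S. finite S \<and> S \<subseteq> Z \<and> (\<forall>z\<in>Z. \<exists>s\<in>span S. z - s \<in> B))"

definition graph_inner :: "('a::real_inner \<Rightarrow> 'a) \<Rightarrow> 'a \<Rightarrow> 'a \<Rightarrow> real" where
  "graph_inner d u v = u \<bullet> v + d u \<bullet> d v"

definition graph_norm :: "('a::real_inner \<Rightarrow> 'a) \<Rightarrow> 'a \<Rightarrow> real" where
  "graph_norm d u = sqrt (graph_inner d u u)"

text \<open>\<open>X\<close> carries the graph norm of \<open>d\<close>, \<open>Y\<close> the norm of the ambient space.\<close>

definition graph_compactly_included :: "('a::real_inner \<Rightarrow> 'a) \<Rightarrow> 'a set \<Rightarrow> 'a set \<Rightarrow> bool" where
  "graph_compactly_included d X Y \<longleftrightarrow> X \<subseteq> Y \<and>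
     (\<forall>S\<subseteq>X. (\<exists>M. \<forall>u\<in>S. graph_norm d u \<le> M) \<longrightarrow> (\<exists>K\<subseteq>Y. compact K \<and> S \<subseteq> K))"

definition diffuse_Fredholm_nilpotent :: "'a::real_inner set \<Rightarrow> ('a \<Rightarrow> 'a) \<Rightarrow> bool" where
  "diffuse_Fredholm_nilpotent V d \<longleftrightarrow> nilpotent_operator V d \<and>
     closed (d ` V) \<and>
     finite_codim_in (d ` V) (kernel_on V d) \<and>
     graph_compactly_included d (V \<inter> (kernel_on V d)\<^sup>\<bottom>) ((kernel_on V d)\<^sup>\<bottom>)"

text \<open>
  Adjoint of an operator \<open>d\<close> in the Hilbert space \<open>X\<close> (a closed subspace of the ambient space, with
  the ambient inner product), with domain \<open>D\<close> dense in \<open>X\<close>; density makes the value unique.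
\<close>

definition adjoint_dom :: "'a::real_inner set \<Rightarrow> 'a set \<Rightarrow> ('a \<Rightarrow> 'a) \<Rightarrow> 'a set" where
  "adjoint_dom X D d = {v \<in> X. \<exists>w\<in>X. \<forall>u\<in>D. d u \<bullet> v = u \<bullet> w}"

definition adjoint_op :: "'a::real_inner set \<Rightarrow> 'a set \<Rightarrow> ('a \<Rightarrow> 'a) \<Rightarrow> 'a \<Rightarrow> 'a" where
  "adjoint_op X D d v = (THE w. w \<in> X \<and> (\<forall>u\<in>D. d u \<bullet> v = u \<bullet> w))"

definition adjoint_range :: "'a::real_inner set \<Rightarrow> 'a set \<Rightarrow> ('a \<Rightarrow> 'a) \<Rightarrow> 'a set" where
  "adjoint_range X D d = adjoint_op X D d ` adjoint_dom X D d"

text \<open>Meaningful for closed subspaces \<open>X\<close> of a Hilbert space.\<close>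

definition orth_proj :: "'a::real_inner set \<Rightarrow> 'a \<Rightarrow> 'a" where
  "orth_proj X w = (THE x. x \<in> X \<and> w - x \<in> X\<^sup>\<bottom>)"

text \<open>
  \<open>(u, p)\<close> solves the mixed variational problem posed on \<open>V\<close> with data \<open>f\<close>.  With \<open>V\<close> the domain of
  \<open>d\<close> this is the continuous problem, with a subspace \<open>V\<^sub>h\<close> in place of \<open>V\<close> the discrete one.
\<close>

definition solves :: "'a::real_inner set \<Rightarrow> ('a \<Rightarrow> 'a) \<Rightarrow> 'a \<Rightarrow> 'a \<Rightarrow> 'a \<Rightarrow> bool" where
  "solves V d f u p \<longleftrightarrow> u \<in> V \<and> p \<in> harmonic V d \<and>
     (\<forall>v\<in>V. d u \<bullet> v + u \<bullet> d v + p \<bullet> v = f \<bullet> v) \<and>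
     (\<forall>q\<in>harmonic V d. u \<bullet> q = 0)"

definition solution_op :: "'a::real_inner set \<Rightarrow> ('a \<Rightarrow> 'a) \<Rightarrow> 'a \<Rightarrow> 'a" where
  "solution_op V d f = (THE u. \<exists>p. solves V d f u p)"

definition bounded_projection_onto :: "'a::real_normed_vector set \<Rightarrow> ('a \<Rightarrow> 'a) \<Rightarrow> bool" where
  "bounded_projection_onto U \<pi> \<longleftrightarrow> bounded_linear \<pi> \<and> (\<forall>w. \<pi> (\<pi> w) = \<pi> w) \<and> range \<pi> = U"

definition best_error :: "'a::real_normed_vector set \<Rightarrow> 'a \<Rightarrow> real" where
  "best_error U w = (INF v\<in>U. norm (w - v))"

end

theory Submission
  imports Defs
begin

text \<open>
  Let \<open>y\<close> and \<open>w\<close> be the components of \<open>u\<close> and \<open>u\<^sub>h\<close> orthogonal to \<open>ker d\<close> and \<open>ker d\<^sub>h\<close>, and let \<open>x\<close> be the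
  component of \<open>w\<close> orthogonal to \<open>ker d\<close>.  Since \<open>d u\<^sub>h\<close> is the orthogonal projection of \<open>d u\<close> onto
  the discrete range, \<open>g = d u - d u\<^sub>h\<close> is bounded by \<open>d u - \<pi>\<^sub>h (d u)\<close>.  Duality gives
  \<open>\<parallel>y - x\<parallel> \<le> \<eta> \<parallel>g\<parallel>\<close>.  As \<open>\<pi>\<^sub>h x - w\<close> lies in \<open>ker d\<^sub>h\<close>, it is orthogonal to \<open>w - x\<close>, so
  \<open>\<parallel>w - x\<parallel> \<le> \<parallel>x - \<pi>\<^sub>h x\<parallel>\<close>; writing \<open>x = y - K g\<close> bounds this by \<open>\<parallel>y - \<pi>\<^sub>h y\<parallel> + \<eta> \<parallel>g\<parallel>\<close>.
\<close>

section \<open>Orthogonal projections and Riesz representation in Hilbert space\<close>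

lemma orthogonal_comp_iff: "x \<in> X\<^sup>\<bottom> \<longleftrightarrow> (\<forall>y\<in>X. x \<bullet> y = 0)"
  by (auto simp: orthogonal_comp_def orthogonal_def inner_commute)

lemma orthogonal_if_norm_minimal:
  fixes e y :: "'a::real_inner"
  assumes "\<And>t. norm e \<le> norm (e - t *\<^sub>R y)"
  shows "e \<bullet> y = 0"
proof (cases "y = 0")
  case False
  \<comment> \<open>The minimiser over \<open>t\<close> of the squared norm of
    \<open>e - t *\<^sub>R y\<close>, where the hypothesis is sharpest.\<close>
  define t where "t = (e \<bullet> y) / (y \<bullet> y)"
  have pos: "y \<bullet> y > 0" using False by simp
  have "(norm e)\<^sup>2 \<le> (norm (e - t *\<^sub>R y))\<^sup>2"
    using assms[of t] by (intro power_mono) auto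
  also have "\<dots> = (norm e)\<^sup>2 - 2 * t * (e \<bullet> y) + t\<^sup>2 * (y \<bullet> y)"
    unfolding power2_norm_eq_inner
    by (simp add: inner_diff inner_commute algebra_simps power2_eq_square)
  also have "\<dots> = (norm e)\<^sup>2 - (e \<bullet> y)\<^sup>2 / (y \<bullet> y)"
    using pos by (simp add: t_def field_simps power2_eq_square)
  finally have "(e \<bullet> y)\<^sup>2 / (y \<bullet> y) \<le> 0" by simp
  then show ?thesis
    using pos by (simp add: divide_le_0_iff)
qed simp

text \<open>A minimising sequence for the distance from \<open>w\<close> to \<open>X\<close> is
  Cauchy by the parallelogram law, because midpoints stay in \<open>X\<close>. Its limit attains the
  distance, and a minimal residual is orthogonal to every direction in \<open>X\<close>.\<close>

lemma orthogonal_decomposition_exists: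
  fixes X :: "'a::{real_inner, complete_space} set"
  assumes X: "subspace X" "closed X"
  shows "\<exists>x\<in>X. w - x \<in> X\<^sup>\<bottom>"
proof -
  define \<delta> where "\<delta> = infdist w X"
  have ne: "X \<noteq> {}" using X(1) subspace_0 by blast
  have \<delta>0: "\<delta> \<ge> 0" by (simp add: \<delta>_def infdist_nonneg)
  have low: "\<delta> \<le> norm (w - x)" if "x \<in> X" for x
    using infdist_le[OF that, of w] by (simp add: \<delta>_def dist_norm)
  have "\<exists>x\<in>X. (norm (w - x))\<^sup>2 < \<delta>\<^sup>2 + inverse (real (Suc n))" for n
  proof -
    have "\<delta> < sqrt (\<delta>\<^sup>2 + inverse (real (Suc n)))"
      by (rule real_less_rsqrt) simp
    then obtain x where "x \<in> X" "norm (w - x) < sqrt (\<delta>\<^sup>2 + inverse (real (Suc n)))"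
      using cInf_lessD[of "dist w ` X"] ne by (auto simp: \<delta>_def infdist_def dist_norm)
    then have "(norm (w - x))\<^sup>2 < (sqrt (\<delta>\<^sup>2 + inverse (real (Suc n))))\<^sup>2"
      by (intro power_strict_mono) auto
    then show ?thesis using \<open>x \<in> X\<close> by (auto simp: add_nonneg_nonneg)
  qed
  then obtain x where xX: "\<And>n. x n \<in> X"
    and up: "\<And>n. (norm (w - x n))\<^sup>2 < \<delta>\<^sup>2 + inverse (real (Suc n))"
    by metis
  have para: "(norm (x m - x n))\<^sup>2 \<le> 2 * inverse (real (Suc m)) + 2 * inverse (real (Suc n))" for m n
  proof -
    let ?a = "w - x m" and ?b = "w - x n"
    have mid: "(1/2) *\<^sub>R (x m + x n) \<in> X"
      using X(1) xX by (simp add: subspace_add subspace_scale)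
    have "\<delta>\<^sup>2 \<le> (norm (w - (1/2) *\<^sub>R (x m + x n)))\<^sup>2"
      using low[OF mid] \<delta>0 by (rule power_mono)
    also have "w - (1/2) *\<^sub>R (x m + x n) = (1/2) *\<^sub>R (?a + ?b)"
      by (simp add: algebra_simps flip: scaleR_add_left)
    also have "(norm \<dots>)\<^sup>2 = (norm (?a + ?b))\<^sup>2 / 4"
      by (simp add: power_divide)
    finally have "4 * \<delta>\<^sup>2 \<le> (norm (?a + ?b))\<^sup>2" by simp
    moreover have "(norm (?a + ?b))\<^sup>2 + (norm (?b - ?a))\<^sup>2 = 2 * (norm ?a)\<^sup>2 + 2 * (norm ?b)\<^sup>2"
      by (simp only: power2_norm_eq_inner inner_diff_left inner_diff_right inner_add_left
          inner_add_right inner_commute) (simp add: inner_commute)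
    moreover have "?b - ?a = x m - x n" by simp
    ultimately show ?thesis using up[of m] up[of n] by auto
  qed
  have "Cauchy x"
  proof (rule CauchyI)
    fix e :: real assume e: "e > 0"
    then obtain N where N: "inverse (real (Suc N)) < e\<^sup>2 / 4"
      using reals_Archimedean[of "e\<^sup>2 / 4"] by auto
    have "norm (x m - x n) < e" if "m \<ge> N" "n \<ge> N" for m n
    proof -
      have "inverse (real (Suc k)) \<le> inverse (real (Suc N))" if "k \<ge> N" for k
        using that by (intro le_imp_inverse_le) auto
      from this[OF that(1)] this[OF that(2)] have "(norm (x m - x n))\<^sup>2 < e\<^sup>2"
        using para[of m n] N by linarith
      then show ?thesis using e by (simp add: power_less_imp_less_base)
    qed
    then show "\<exists>M. \<forall>m\<ge>M. \<forall>n\<ge>M. norm (x m - x n) < e" by blast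
  qed
  then obtain l where l: "x \<longlonglongrightarrow> l"
    using Cauchy_convergent convergent_def by blast
  have lX: "l \<in> X" using closed_sequentially[OF X(2)] xX l by blast
  have A: "(\<lambda>n. \<delta>\<^sup>2 + inverse (real (Suc n))) \<longlonglongrightarrow> \<delta>\<^sup>2 + 0"
    by (intro tendsto_intros LIMSEQ_inverse_real_of_nat)
  have "(\<lambda>n. (norm (w - x n))\<^sup>2) \<longlonglongrightarrow> (norm (w - l))\<^sup>2"
    by (intro tendsto_intros l)
  from LIMSEQ_le[OF this A] up have "(norm (w - l))\<^sup>2 \<le> \<delta>\<^sup>2 + 0"
    by (meson less_imp_le)
  then have le: "norm (w - l) \<le> \<delta>"
    using \<delta>0 by (auto intro: power2_le_imp_le)
  have "(w - l) \<bullet> y = 0" if "y \<in> X" for y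
  proof (rule orthogonal_if_norm_minimal)
    fix t
    have "l + t *\<^sub>R y \<in> X" using X(1) lX that by (simp add: subspace_add subspace_scale)
    from low[OF this] le show "norm (w - l) \<le> norm (w - l - t *\<^sub>R y)"
      by (simp add: algebra_simps)
  qed
  then show ?thesis using lX by (auto simp: orthogonal_comp_iff)
qed

lemma orth_proj_eqI:
  assumes "subspace X" "x \<in> X" "w - x \<in> X\<^sup>\<bottom>"
  shows "orth_proj X w = x"
  unfolding orth_proj_def
proof (rule the_equality)
  show "x \<in> X \<and> w - x \<in> X\<^sup>\<bottom>" using assms by simp
  fix y assume y: "y \<in> X \<and> w - y \<in> X\<^sup>\<bottom>"
  have "y - x \<in> X" using assms y by (simp add: subspace_diff)
  then have "(w - x) \<bullet> (y - x) = 0" "(w - y) \<bullet> (y - x) = 0"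
    using assms y by (auto simp: orthogonal_comp_iff)
  then have "(y - x) \<bullet> (y - x) = 0" by (simp add: inner_diff_left)
  then show "y = x" by simp
qed

lemma orth_proj:
  fixes X :: "'a::{real_inner, complete_space} set"
  assumes "subspace X" "closed X"
  shows orth_proj_mem: "orth_proj X w \<in> X"
    and orth_proj_perp: "w - orth_proj X w \<in> X\<^sup>\<bottom>"
  using orthogonal_decomposition_exists[OF assms, of w] orth_proj_eqI[OF assms(1), of _ w] by auto

text \<open>With \<open>N\<close> the null space of \<open>\<phi>\<close> in \<open>X\<close> and
  \<open>e\<close> the component of \<open>x0\<close> orthogonal to \<open>N\<close>, every
  \<open>x\<close> in \<open>X\<close> is a multiple of \<open>e\<close> modulo \<open>N\<close>, so
  a rescaled \<open>e\<close> represents \<open>\<phi>\<close>. Linearity is asked on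
  \<open>X\<close> alone because the functional needed later is built from potentials chosen on the
  range of \<open>d\<close>.\<close>

lemma Riesz_representation:
  fixes X :: "'a::{real_inner, complete_space} set"
  assumes X: "subspace X" "closed X"
    and add: "\<And>x y. x \<in> X \<Longrightarrow> y \<in> X \<Longrightarrow> \<phi> (x + y) = \<phi> x + \<phi> y"
    and scale: "\<And>a x. x \<in> X \<Longrightarrow> \<phi> (a *\<^sub>R x) = a * \<phi> x"
    and bound: "\<And>x. x \<in> X \<Longrightarrow> \<bar>\<phi> x\<bar> \<le> C * norm x"
  shows "\<exists>y\<in>X. \<forall>x\<in>X. \<phi> x = x \<bullet> y"
proof (cases "\<forall>x\<in>X. \<phi> x = 0")
  case True
  then show ?thesis using subspace_0[OF X(1)] by (intro bexI[of _ 0]) auto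
next
  case False
  then obtain x0 where x0: "x0 \<in> X" "\<phi> x0 \<noteq> 0" by blast
  define N where "N = {x \<in> X. \<phi> x = 0}"
  have diff: "\<phi> (x - y) = \<phi> x - \<phi> y" if "x \<in> X" "y \<in> X" for x y
    using add[of x "- 1 *\<^sub>R y"] scale[of y "-1"] that X(1) by (simp add: subspace_neg)
  have \<phi>0: "\<phi> 0 = 0" using scale[of x0 0] x0 by simp
  have N: "subspace N"
    using X(1) by (auto simp: N_def subspace_def \<phi>0 add scale)
  have "closed N"
    unfolding closed_sequential_limits
  proof (intro allI impI)
    fix s l assume s: "(\<forall>n. s n \<in> N) \<and> s \<longlonglongrightarrow> l"
    then have lX: "l \<in> X" using closed_sequentially[OF X(2)] by (auto simp: N_def)
    have "\<bar>\<phi> l\<bar> \<le> C * norm (l - s n)" for n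
      using bound[of "l - s n"] diff[of l "s n"] lX s X(1) by (auto simp: N_def subspace_diff)
    moreover have "(\<lambda>n. C * norm (l - s n)) \<longlonglongrightarrow> C * norm (l - l)"
      using s by (intro tendsto_intros) auto
    ultimately have "\<bar>\<phi> l\<bar> \<le> C * norm (l - l)"
      by (intro LIMSEQ_le_const) auto
    then show "l \<in> N" using lX by (simp add: N_def)
  qed
  note N = N this
  define e where "e = x0 - orth_proj N x0"
  have pN: "orth_proj N x0 \<in> N" and eN: "e \<in> N\<^sup>\<bottom>"
    using orth_proj[OF N, of x0] by (auto simp: e_def)
  have eX: "e \<in> X" and \<phi>e: "\<phi> e = \<phi> x0"
    using pN x0 X(1) by (auto simp: e_def N_def subspace_diff diff)
  have ee: "e \<bullet> e \<noteq> 0" using \<phi>e x0 \<phi>0 by auto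
  show ?thesis
  proof (intro bexI ballI)
    show "(\<phi> e / (e \<bullet> e)) *\<^sub>R e \<in> X" using eX X(1) by (simp add: subspace_scale)
    fix x assume x: "x \<in> X"
    have sX: "(\<phi> x / \<phi> e) *\<^sub>R e \<in> X" using eX X(1) by (simp add: subspace_scale)
    have "x - (\<phi> x / \<phi> e) *\<^sub>R e \<in> N"
      using x X(1) eX sX \<phi>e x0 by (simp add: N_def subspace_diff diff scale)
    then have "e \<bullet> (x - (\<phi> x / \<phi> e) *\<^sub>R e) = 0"
      using eN by (simp add: orthogonal_comp_iff)
    then have "e \<bullet> x = \<phi> x / \<phi> e * (e \<bullet> e)" by (simp add: inner_diff_right)
    then show "\<phi> x = x \<bullet> ((\<phi> e / (e \<bullet> e)) *\<^sub>R e)"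
      using ee \<phi>e x0 by (simp add: inner_commute)
  qed
qed

section \<open>Complexes with a Poincare inequality\<close>

text \<open>The assumptions fit both the domain \<open>V\<close> and each discrete subspace, so one
  theory serves both variational problems. The constant is a parameter in order to track how it
  passes to the discrete complex.\<close>

locale poincare_complex =
  fixes D :: "'a::{real_inner, complete_space} set" and d :: "'a \<Rightarrow> 'a" and c :: real
  assumes lin: "linear_operator_on D d"
    and range_sub_ker: "d ` D \<subseteq> kernel_on D d"
    and closed_ker: "closed (kernel_on D d)"
    and closed_ran: "closed (d ` D)"
    and c_nonneg: "c \<ge> 0"
    and poincare: "\<And>v. v \<in> D \<Longrightarrow> v \<in> (kernel_on D d)\<^sup>\<bottom> \<Longrightarrow> norm v \<le> c * norm (d v)"
begin

abbreviation "Z \<equiv> kernel_on D d"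
abbreviation "B \<equiv> d ` D"

section \<open>Kernel, range, potentials and the range of the adjoint\<close>

lemma subspace_D: "subspace D" using lin by (simp add: linear_operator_on_def)

lemma d_add: "u \<in> D \<Longrightarrow> v \<in> D \<Longrightarrow> d (u + v) = d u + d v"
  and d_scale: "u \<in> D \<Longrightarrow> d (a *\<^sub>R u) = a *\<^sub>R d u"
  using lin by (auto simp: linear_operator_on_def)

lemma d_0: "d 0 = 0"
  using d_scale[of 0 0] subspace_0[OF subspace_D] by simp

lemma d_diff: "u \<in> D \<Longrightarrow> v \<in> D \<Longrightarrow> d (u - v) = d u - d v"
  using d_add[of u "- 1 *\<^sub>R v"] d_scale[of v "-1"] subspace_D by (simp add: subspace_neg)

lemma dd: "u \<in> D \<Longrightarrow> d u \<in> D" "u \<in> D \<Longrightarrow> d (d u) = 0" "u \<in> D \<Longrightarrow> d u \<in> Z"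
  using range_sub_ker by (auto simp: kernel_on_def)

lemma subspace_Z: "subspace Z"
  using subspace_D by (auto simp: subspace_def kernel_on_def d_0 d_add d_scale)

lemma subspace_B: "subspace B"
  unfolding subspace_def
proof (intro conjI ballI allI)
  show "0 \<in> B" using d_0 subspace_0[OF subspace_D] by (metis imageI)
next
  fix x y assume "x \<in> B" "y \<in> B"
  then show "x + y \<in> B" using d_add subspace_D by (smt (verit) imageE imageI subspace_add)
next
  fix a x assume "x \<in> B"
  then show "a *\<^sub>R x \<in> B" using d_scale subspace_D by (smt (verit) imageE imageI subspace_scale)
qed

lemma proj_Z_compl:
  assumes "u \<in> D"
  shows "u - orth_proj Z u \<in> D" "d (u - orth_proj Z u) = d u" "u - orth_proj Z u \<in> Z\<^sup>\<bottom>"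
proof -
  have "orth_proj Z u \<in> Z" "u - orth_proj Z u \<in> Z\<^sup>\<bottom>"
    by (rule orth_proj[OF subspace_Z closed_ker])+
  then show "u - orth_proj Z u \<in> D" "d (u - orth_proj Z u) = d u" "u - orth_proj Z u \<in> Z\<^sup>\<bottom>"
    using assms subspace_D by (auto simp: kernel_on_def subspace_diff d_diff)
qed

lemma potential_exists:
  assumes "b \<in> B"
  obtains v where "v \<in> D" "v \<in> Z\<^sup>\<bottom>" "d v = b"
  using assms proj_Z_compl by (metis imageE)

lemma potential_unique:
  assumes "u \<in> D" "v \<in> D" "u \<in> Z\<^sup>\<bottom>" "v \<in> Z\<^sup>\<bottom>" "d u = d v"
  shows "u = v"
proof -
  have "norm (u - v) \<le> c * norm (d (u - v))"
    using assms subspace_D by (intro poincare) (auto simp: subspace_diff orthogonal_comp_iff inner_diff_left)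
  then show ?thesis using assms by (simp add: d_diff)
qed

text \<open>A closed range argument. Sending \<open>b\<close> in \<open>B\<close> to its potential
  \<open>S b\<close> orthogonal to \<open>Z\<close> is linear by uniqueness and bounded by the
  Poincare inequality, so \<open>z\<close> can be the Riesz representer of the functional
  \<open>S b \<bullet> w\<close> of \<open>b\<close>.\<close>

lemma weak_adjoint_preimage:
  assumes w: "w \<in> Z\<^sup>\<bottom>"
  shows "\<exists>z\<in>B. \<forall>v\<in>D. d v \<bullet> z = v \<bullet> w"
proof -
  have "\<forall>b\<in>B. \<exists>v. v \<in> D \<and> v \<in> Z\<^sup>\<bottom> \<and> d v = b"
    by (rule ballI, erule potential_exists) blast
  from bchoice[OF this] obtain S
    where S: "\<And>b. b \<in> B \<Longrightarrow> S b \<in> D \<and> S b \<in> Z\<^sup>\<bottom> \<and> d (S b) = b"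
    by blast
  have sD: "subspace D" by (rule subspace_D)
  have "\<exists>z\<in>B. \<forall>b\<in>B. S b \<bullet> w = b \<bullet> z"
  proof (rule Riesz_representation[OF subspace_B closed_ran])
    fix x y assume xy: "x \<in> B" "y \<in> B"
    have "S (x + y) = S x + S y"
      by (rule potential_unique)
        (use S[OF xy(1)] S[OF xy(2)] S[OF subspace_add[OF subspace_B xy]] sD in
          \<open>auto simp: subspace_add d_add orthogonal_comp_iff inner_add_left\<close>)
    then show "S (x + y) \<bullet> w = S x \<bullet> w + S y \<bullet> w" by (simp add: inner_add_left)
  next
    fix a x assume x: "x \<in> B"
    have "S (a *\<^sub>R x) = a *\<^sub>R S x"
      by (rule potential_unique)
        (use S[OF x] S[OF subspace_scale[OF subspace_B x, of a]] sD in
          \<open>auto simp: subspace_scale d_scale orthogonal_comp_iff\<close>)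
    then show "S (a *\<^sub>R x) \<bullet> w = a * (S x \<bullet> w)" by simp
  next
    fix x assume x: "x \<in> B"
    have "\<bar>S x \<bullet> w\<bar> \<le> norm (S x) * norm w" by (rule Cauchy_Schwarz_ineq2)
    also have "\<dots> \<le> (c * norm x) * norm w"
      using poincare[of "S x"] S[OF x] by (intro mult_right_mono) auto
    finally show "\<bar>S x \<bullet> w\<bar> \<le> (c * norm w) * norm x" by (simp add: algebra_simps)
  qed
  then obtain z where z: "z \<in> B" "\<And>b. b \<in> B \<Longrightarrow> S b \<bullet> w = b \<bullet> z" by blast
  have "d v \<bullet> z = v \<bullet> w" if v: "v \<in> D" for v
  proof -
    \<comment> \<open>An arbitrary \<open>v\<close> differs from the potential of \<open>d v\<close>
      by a kernel element, which is orthogonal to \<open>w\<close>.\<close>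
    have "v - S (d v) \<in> Z"
      using S[of "d v"] v sD by (auto simp: kernel_on_def subspace_diff d_diff)
    then have "w \<bullet> (v - S (d v)) = 0" using w by (auto simp: orthogonal_comp_iff)
    then show ?thesis using z(2)[of "d v"] v by (simp add: inner_diff_right inner_commute)
  qed
  then show ?thesis using z by blast
qed

text \<open>Density of \<open>D\<close> in \<open>X\<close> makes the adjoint single-valued. Testing
  with kernel elements gives one inclusion; for the other, the preimage from
  \<open>weak_adjoint_preimage\<close> lies in \<open>B\<close>, hence in \<open>X\<close>. The
  instances used are \<open>X = UNIV\<close> for the continuous complex and \<open>X = D\<close> for
  the discrete one.\<close>

lemma adjoint_range_eq:
  assumes X: "subspace X" "D \<subseteq> X" "X \<subseteq> closure D"
  shows "adjoint_range X D d = X \<inter> Z\<^sup>\<bottom>"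
proof -
  have uniq: "w = w'" if "w \<in> X" "w' \<in> X" "\<And>u. u \<in> D \<Longrightarrow> u \<bullet> w = u \<bullet> w'" for w w'
  proof -
    have "closure D \<subseteq> {x. x \<bullet> (w - w') = 0}"
      using that(3) by (intro closure_minimal closed_Collect_eq continuous_intros)
        (auto simp: inner_diff_right)
    moreover have "w - w' \<in> closure D" using that X by (auto simp: subspace_diff)
    ultimately have "(w - w') \<bullet> (w - w') = 0" by blast
    then show ?thesis by simp
  qed
  have op: "adjoint_op X D d v = w" if "w \<in> X" "\<forall>u\<in>D. d u \<bullet> v = u \<bullet> w" for v w
    unfolding adjoint_op_def using that by (intro the_equality) (auto intro: uniq)
  show ?thesis
  proof (intro equalityI subsetI)
    fix w assume "w \<in> adjoint_range X D d"
    then obtain v where v: "w \<in> X" "\<forall>u\<in>D. d u \<bullet> v = u \<bullet> w"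
      using op by (auto simp: adjoint_range_def adjoint_dom_def)
    have "w \<bullet> z = 0" if "z \<in> Z" for z
      using v(2) that by (auto simp: kernel_on_def inner_commute)
    with v show "w \<in> X \<inter> Z\<^sup>\<bottom>" by (auto simp: orthogonal_comp_iff)
  next
    fix w assume w: "w \<in> X \<inter> Z\<^sup>\<bottom>"
    then obtain v where v: "v \<in> B" "\<forall>u\<in>D. d u \<bullet> v = u \<bullet> w"
      using weak_adjoint_preimage by blast
    then have "v \<in> adjoint_dom X D d"
      using w X dd by (auto simp: adjoint_dom_def)
    with op[of w v] v w show "w \<in> adjoint_range X D d"
      by (auto simp: adjoint_range_def image_iff)
  qed
qed

text \<open>Replaces the projections in the theorem by \<open>u - orth_proj Z u\<close>, which stays
  in \<open>D\<close> and has the same image under \<open>d\<close> as \<open>u\<close>.\<close>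

lemma orth_proj_adjoint_range:
  assumes "subspace X" "D \<subseteq> X" "X \<subseteq> closure D" "u \<in> D"
  shows "orth_proj (adjoint_range X D d) u = u - orth_proj Z u"
  unfolding adjoint_range_eq[OF assms(1-3)]
proof (rule orth_proj_eqI)
  show "subspace (X \<inter> Z\<^sup>\<bottom>)"
    using assms(1) by (auto simp: subspace_def orthogonal_comp_iff inner_add_left)
  show "u - orth_proj Z u \<in> X \<inter> Z\<^sup>\<bottom>"
    using proj_Z_compl[OF assms(4)] assms by auto
  show "u - (u - orth_proj Z u) \<in> (X \<inter> Z\<^sup>\<bottom>)\<^sup>\<bottom>"
    using orth_proj_mem[OF subspace_Z closed_ker, of u]
    by (auto simp: orthogonal_comp_iff inner_commute)
qed

section \<open>The mixed variational problem: existence, stability and uniqueness\<close>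

lemma harmonic_iff: "q \<in> harmonic D d \<longleftrightarrow> q \<in> Z \<and> (\<forall>v\<in>D. q \<bullet> d v = 0)"
  by (auto simp: harmonic_def orthogonal_comp_iff)

lemma subspace_harmonic: "subspace (harmonic D d)"
  using subspace_Z by (auto simp: subspace_def harmonic_iff inner_add_left)

text \<open>Testing with \<open>d v\<close> removes the second term by nilpotency and the third by
  harmonicity of \<open>p\<close>. Thus \<open>d u\<close> is the orthogonal projection of
  \<open>f\<close> onto the range.\<close>

lemma solves_range:
  assumes "solves D d f u p" "v \<in> D"
  shows "d u \<bullet> d v = f \<bullet> d v"
  using assms dd[OF assms(2)] by (auto simp: solves_def harmonic_iff)

text \<open>Given uniqueness, the solution operator inverts \<open>d\<close> on vectors orthogonal
  to \<open>Z\<close>; by \<open>solves_adjoint_preimage\<close> it also inverts the adjoint. The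
  error estimate uses both facts.\<close>

lemma solves_potential:
  assumes "u \<in> D" "u \<in> Z\<^sup>\<bottom>"
  shows "solves D d (d u) u 0"
  using assms dd subspace_0[OF subspace_harmonic]
  by (auto simp: solves_def orthogonal_comp_iff harmonic_iff)

lemma solves_adjoint_preimage:
  assumes "z \<in> B" "\<And>v. v \<in> D \<Longrightarrow> d v \<bullet> z = v \<bullet> w"
  shows "solves D d w z 0"
  using assms dd subspace_0[OF subspace_harmonic]
  by (auto simp: solves_def harmonic_iff inner_commute)

lemma solves_add:
  assumes "solves D d f u p" "solves D d f' u' p'"
  shows "solves D d (f + f') (u + u') (p + p')"
  using assms subspace_D subspace_harmonic
  by (auto simp: solves_def subspace_add d_add inner_add_left) (smt (verit))

lemma solves_scale:
  assumes "solves D d f u p"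
  shows "solves D d (a *\<^sub>R f) (a *\<^sub>R u) (a *\<^sub>R p)"
  using assms subspace_D subspace_harmonic
  by (auto simp: solves_def subspace_scale d_scale simp flip: distrib_left)

text \<open>The Hodge decomposition splits \<open>f\<close> into \<open>b\<close> in the range, a
  harmonic \<open>a - b\<close>, and \<open>f - a\<close> orthogonal to the kernel. Each part is
  solved separately: by a potential, by zero, and by a weak adjoint preimage.\<close>

lemma solution_exists: "\<exists>u p. solves D d f u p"
proof -
  define a where "a = orth_proj Z f"
  define b where "b = orth_proj B a"
  have a: "a \<in> Z" "f - a \<in> Z\<^sup>\<bottom>"
    unfolding a_def by (rule orth_proj[OF subspace_Z closed_ker])+
  have b: "b \<in> B" "a - b \<in> B\<^sup>\<bottom>"
    unfolding b_def by (rule orth_proj[OF subspace_B closed_ran])+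
  have h: "a - b \<in> harmonic D d"
    using a b range_sub_ker subspace_Z by (auto simp: harmonic_def intro!: subspace_diff)
  have h': "solves D d (a - b) 0 (a - b)"
    using h subspace_0[OF subspace_D] by (auto simp: solves_def d_0)
  obtain y where y: "y \<in> D" "y \<in> Z\<^sup>\<bottom>" "d y = b"
    using potential_exists[OF b(1)] by blast
  obtain z where z: "z \<in> B" "\<forall>v\<in>D. d v \<bullet> z = v \<bullet> (f - a)"
    using weak_adjoint_preimage[OF a(2)] by blast
  have "solves D d (b + (f - a) + (a - b)) (y + z + 0) (0 + 0 + (a - b))"
    using solves_potential[OF y(1,2)] solves_adjoint_preimage[OF z(1)] z(2) h' y(3)
    by (intro solves_add) auto
  then show ?thesis by auto
qed

text \<open>The components \<open>y\<close> and \<open>z\<close> of \<open>u\<close>, orthogonal to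
  \<open>Z\<close> and in \<open>Z\<close>, each contribute \<open>c * norm f\<close>, whence the
  factor 2.\<close>

lemma solution_bound:
  assumes sol: "solves D d f u p"
  shows "norm u \<le> 2 * c * norm f"
proof -
  have u: "u \<in> D" and p: "p \<in> harmonic D d"
    and eq: "\<And>v. v \<in> D \<Longrightarrow> d u \<bullet> v + u \<bullet> d v + p \<bullet> v = f \<bullet> v"
    and uq: "\<And>q. q \<in> harmonic D d \<Longrightarrow> u \<bullet> q = 0"
    using sol by (auto simp: solves_def)
  \<comment> \<open>The test function is \<open>d u\<close> itself.\<close>
  have "(norm (d u))\<^sup>2 \<le> norm f * norm (d u)"
    using solves_range[OF sol u] norm_cauchy_schwarz[of f "d u"] by (simp add: power2_norm_eq_inner)
  then have du: "norm (d u) \<le> norm f"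
    by (cases "d u = 0") (auto simp: power2_eq_square)
  define z where "z = orth_proj Z u"
  define y where "y = u - z"
  have zZ: "z \<in> Z" unfolding z_def by (rule orth_proj_mem[OF subspace_Z closed_ker])
  have y: "y \<in> D" "d y = d u" "y \<in> Z\<^sup>\<bottom>" unfolding y_def z_def by (rule proj_Z_compl[OF u])+
  have ny: "norm y \<le> c * norm f"
    using poincare[OF y(1,3)] y(2) mult_left_mono[OF du c_nonneg] by simp
  define b where "b = orth_proj B z"
  have b: "b \<in> B" "z - b \<in> B\<^sup>\<bottom>"
    unfolding b_def by (rule orth_proj[OF subspace_B closed_ran])+
  have bZ: "b \<in> Z" using b range_sub_ker by blast
  have h: "z - b \<in> harmonic D d"
    using b bZ zZ subspace_Z by (auto simp: harmonic_def intro!: subspace_diff)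
  have "u \<bullet> (z - b) = 0" by (rule uq[OF h])
  moreover have "y \<bullet> (z - b) = 0" using y(3) h by (auto simp: harmonic_iff orthogonal_comp_iff)
  moreover have "b \<bullet> (z - b) = 0" using b by (auto simp: orthogonal_comp_iff inner_commute)
  \<comment> \<open>The harmonic part of \<open>z\<close> is orthogonal to \<open>u\<close>,
    \<open>y\<close> and \<open>b\<close>, hence to itself; so \<open>z\<close> lies in the range
    and has a potential.\<close>
  ultimately have "(z - b) \<bullet> (z - b) = 0" by (simp add: y_def inner_diff_left)
  then have "z \<in> B" using b by simp
  then obtain v where v: "v \<in> D" "v \<in> Z\<^sup>\<bottom>" "d v = z" using potential_exists by blast
  \<comment> \<open>Testing with the potential \<open>v\<close> of \<open>z\<close> isolates
    \<open>z\<close>: both \<open>d u\<close> and \<open>p\<close> lie in \<open>Z\<close>, to which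
    \<open>v\<close> is orthogonal.\<close>
  have "v \<bullet> d u = 0" "v \<bullet> p = 0" "y \<bullet> z = 0"
    using v(2) y(3) dd(3)[OF u] p zZ by (auto simp: orthogonal_comp_iff harmonic_iff)
  moreover from this(3) have "u \<bullet> z = z \<bullet> z" by (simp add: y_def inner_diff_left)
  ultimately have "(norm z)\<^sup>2 = f \<bullet> v"
    using eq[OF v(1)] v(3) by (simp add: inner_commute power2_norm_eq_inner)
  also have "\<dots> \<le> norm f * (c * norm z)"
    using norm_cauchy_schwarz[of f v] poincare[OF v(1,2)] v(3)
      mult_left_mono[of "norm v" "c * norm z" "norm f"] by simp
  finally have nz: "norm z \<le> c * norm f"
    using c_nonneg by (cases "z = 0") (auto simp: power2_eq_square mult.commute)
  have "norm u \<le> norm y + norm z" unfolding y_def using norm_triangle_ineq[of "u - z" z] by simp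
  with ny nz show ?thesis by simp
qed

lemma solution_unique:
  assumes "solves D d f u p" "solves D d f u' p'"
  shows "u = u'"
proof -
  have "solves D d (f + (-1) *\<^sub>R f) (u + (-1) *\<^sub>R u') (p + (-1) *\<^sub>R p')"
    by (intro solves_add solves_scale assms)
  from solution_bound[OF this] show ?thesis by simp
qed

lemma solution_op_eq: "solves D d f u p \<Longrightarrow> solution_op D d f = u"
  unfolding solution_op_def by (intro the_equality) (auto intro: solution_unique)

lemma solution_op_solves: "\<exists>p. solves D d f (solution_op D d f) p"
  using solution_exists solution_op_eq by metis

text \<open>Boundedness makes the \<open>onorm\<close> defining \<open>\<eta>\<close> a genuine
  operator norm.\<close>

lemma bounded_linear_solution_op: "bounded_linear (solution_op D d)"
proof (rule bounded_linear_intro[where K = "2 * c"])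
  fix f g a
  obtain p q where *: "solves D d f (solution_op D d f) p" "solves D d g (solution_op D d g) q"
    using solution_op_solves by metis
  show "solution_op D d (f + g) = solution_op D d f + solution_op D d g"
    by (rule solution_op_eq[OF solves_add[OF *]])
  show "solution_op D d (a *\<^sub>R f) = a *\<^sub>R solution_op D d f"
    by (rule solution_op_eq[OF solves_scale[OF *(1)]])
  show "norm (solution_op D d f) \<le> norm f * (2 * c)"
    using solution_bound[OF *(1)] by (simp add: mult.commute)
qed

end

section \<open>The continuous and the discrete complex\<close>

lemma closed_kernel_on:
  assumes "closed_operator_on V d"
  shows "closed (kernel_on V d)"
proof -
  have "kernel_on V d = (\<lambda>u. (u, 0)) -` ((\<lambda>u. (u, d u)) ` V)"
    by (auto simp: kernel_on_def)
  then show ?thesis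
    using assms by (auto simp: closed_operator_on_def intro!: closed_vimage continuous_intros)
qed

text \<open>If the inequality failed, there would be unit vectors orthogonal to the kernel with
  images under \<open>d\<close> tending to zero. Compactness gives a convergent subsequence, and
  closedness of \<open>d\<close> puts its limit in the kernel as well as in the complement, so a
  unit vector would vanish.\<close>

lemma graph_compact_imp_poincare:
  fixes V :: "'a::{real_inner, complete_space} set"
  assumes lin: "linear_operator_on V d" and clo: "closed_operator_on V d"
    and comp: "graph_compactly_included d (V \<inter> (kernel_on V d)\<^sup>\<bottom>) ((kernel_on V d)\<^sup>\<bottom>)"
  shows "\<exists>c\<ge>0. \<forall>v\<in>V \<inter> (kernel_on V d)\<^sup>\<bottom>. norm v \<le> c * norm (d v)"
proof (rule ccontr)
  let ?X = "V \<inter> (kernel_on V d)\<^sup>\<bottom>"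
  assume neg: "\<not> ?thesis"
  have "\<exists>v\<in>?X. norm v = 1 \<and> norm (d v) \<le> inverse (real (Suc n))" for n
  proof -
    have "\<exists>v\<in>?X. norm v > real (Suc n) * norm (d v)"
      using neg by (metis not_le of_nat_0_le_iff)
    then obtain v where v: "v \<in> ?X" "norm v > real (Suc n) * norm (d v)" by blast
    have nv: "norm v > 0" using v(2) by (smt (verit) mult_nonneg_nonneg norm_ge_zero of_nat_0_le_iff)
    have "norm (d ((1 / norm v) *\<^sub>R v)) = norm (d v) / norm v"
      using lin v(1) by (simp add: linear_operator_on_def divide_inverse mult.commute)
    also have "\<dots> \<le> inverse (real (Suc n))"
      using v(2) nv by (simp add: field_simps)
    finally show ?thesis
      using v(1) nv lin
      by (intro bexI[of _ "(1 / norm v) *\<^sub>R v"])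
        (auto simp: linear_operator_on_def subspace_scale orthogonal_comp_iff)
  qed
  then obtain v where v: "\<And>n. v n \<in> ?X" "\<And>n. norm (v n) = 1"
    "\<And>n. norm (d (v n)) \<le> inverse (real (Suc n))"
    by metis
  have "graph_norm d (v n) \<le> sqrt 2" for n
  proof -
    have "norm (d (v n)) \<le> 1"
      using v(3)[of n] by (smt (verit) inverse_le_1_iff of_nat_1 of_nat_le_iff le_add1 plus_1_eq_Suc)
    then have "d (v n) \<bullet> d (v n) \<le> 1"
      by (simp add: dot_square_norm power_le_one)
    then show ?thesis using v(2)[of n] by (simp add: graph_norm_def graph_inner_def dot_square_norm)
  qed
  then have "\<exists>M. \<forall>u\<in>range v. graph_norm d u \<le> M" by blast
  moreover have "range v \<subseteq> ?X" using v(1) by blast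
  ultimately obtain K where K: "K \<subseteq> (kernel_on V d)\<^sup>\<bottom>" "compact K" "range v \<subseteq> K"
    using comp unfolding graph_compactly_included_def by metis
  have "seq_compact K" using K(2) by (simp add: compact_eq_seq_compact_metric)
  then obtain l r where l: "l \<in> K" "strict_mono r" "(v \<circ> r) \<longlonglongrightarrow> l"
    using K(3) unfolding seq_compact_def by (metis rangeI subsetD)
  have "(\<lambda>n. d (v n)) \<longlonglongrightarrow> 0"
    using v(3) by (intro Lim_null_comparison[OF _ LIMSEQ_inverse_real_of_nat]) auto
  then have "(\<lambda>n. d (v (r n))) \<longlonglongrightarrow> 0"
    using LIMSEQ_subseq_LIMSEQ[OF _ l(2)] by (auto simp: o_def)
  then have "(\<lambda>n. (v (r n), d (v (r n)))) \<longlonglongrightarrow> (l, 0)"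
    using l(3) by (intro tendsto_Pair) (auto simp: o_def)
  then have "(l, 0) \<in> (\<lambda>u. (u, d u)) ` V"
    using clo v(1) unfolding closed_operator_on_def by (elim closed_sequentially) auto
  then have "l \<in> kernel_on V d" by (auto simp: kernel_on_def)
  moreover from l(1) K(1) have "l \<in> (kernel_on V d)\<^sup>\<bottom>" by blast
  ultimately have "l \<bullet> l = 0" unfolding orthogonal_comp_iff by blast
  moreover have "(\<lambda>n. norm (v (r n))) \<longlonglongrightarrow> norm l"
    using l(3) by (intro tendsto_norm) (auto simp: o_def)
  then have "norm l = 1" using v(2) LIMSEQ_unique[OF _ tendsto_const] by fastforce
  ultimately show False by simp
qed

lemma diffuse_Fredholm_nilpotent_poincare_complex:
  fixes V :: "'a::{real_inner, complete_space} set"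
  assumes "diffuse_Fredholm_nilpotent V d"
  obtains c where "poincare_complex V d c"
proof -
  have nil: "nilpotent_operator V d" using assms by (simp add: diffuse_Fredholm_nilpotent_def)
  then obtain c where "c \<ge> 0" "\<forall>v\<in>V \<inter> (kernel_on V d)\<^sup>\<bottom>. norm v \<le> c * norm (d v)"
    using graph_compact_imp_poincare[of V d] assms
    by (auto simp: diffuse_Fredholm_nilpotent_def nilpotent_operator_def)
  then have "poincare_complex V d c"
    using nil assms closed_kernel_on[of V d]
    by unfold_locales (auto simp: diffuse_Fredholm_nilpotent_def nilpotent_operator_def)
  then show ?thesis by (rule that)
qed

text \<open>Since \<open>P\<close> fixes \<open>U\<close>, the error at \<open>w\<close> equals the
  error at \<open>w - v\<close> for every \<open>v\<close> in \<open>U\<close>.\<close>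

lemma projection_error_le_best_error:
  assumes proj: "bounded_projection_onto U P" and U: "subspace U" and M: "onorm P \<le> M"
  shows "norm (w - P w) \<le> (1 + M) * best_error U w"
proof -
  have bl: "bounded_linear P" and idem: "\<And>w. P (P w) = P w" and ran: "range P = U"
    using proj by (auto simp: bounded_projection_onto_def)
  have M0: "M \<ge> 0" using onorm_pos_le[OF bl] M by simp
  have le: "norm (w - P w) / (1 + M) \<le> norm (w - v)" if "v \<in> U" for v
  proof -
    have "P v = v" using that ran idem by auto
    then have "w - P w = (w - v) - P (w - v)"
      by (simp add: linear_diff bounded_linear.linear[OF bl])
    also have "norm \<dots> \<le> norm (w - v) + norm (P (w - v))" by (rule norm_triangle_ineq4)
    also have "norm (P (w - v)) \<le> M * norm (w - v)"
      using onorm[OF bl, of "w - v"] mult_right_mono[OF M norm_ge_zero[of "w - v"]] by linarith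
    finally show ?thesis using M0 by (simp add: field_simps)
  qed
  have "norm (w - P w) / (1 + M) \<le> best_error U w"
    unfolding best_error_def using subspace_0[OF U] le by (intro cINF_greatest) auto
  then show ?thesis using M0 by (simp add: field_simps)
qed

text \<open>\<open>M\<close> is any bound on \<open>onorm P\<close>, so that one value can serve all
  \<open>h\<close> and keep the constants uniform.\<close>

locale commuting_projection = poincare_complex +
  fixes U :: "'a set" and P :: "'a \<Rightarrow> 'a" and M :: real
  assumes dense: "closure D = UNIV"
    and U: "subspace U" "closed U" "U \<subseteq> D" "d ` U \<subseteq> U"
    and proj: "bounded_projection_onto U P"
    and M: "onorm P \<le> M"
    and commute: "\<And>v. v \<in> D \<Longrightarrow> P (d v) = d (P v)"
begin

section \<open>The discrete complex\<close>

lemma bounded_linear_P: "bounded_linear P"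
  and P_id: "v \<in> U \<Longrightarrow> P v = v"
  and P_mem: "P w \<in> U"
  using proj by (auto simp: bounded_projection_onto_def)

lemma M_nonneg: "M \<ge> 0"
  using onorm_pos_le[OF bounded_linear_P] M by simp

lemma norm_P: "norm (P w) \<le> M * norm w"
  using onorm[OF bounded_linear_P, of w] mult_right_mono[OF M norm_ge_zero[of w]] by linarith

lemma P_range: "b \<in> B \<Longrightarrow> P b \<in> d ` U"
  using commute P_mem by auto

text \<open>If \<open>d v\<close> lies in \<open>U\<close>, then \<open>P\<close> fixes it, and
  commutation gives \<open>d v = d (P v)\<close>. The discrete range is therefore closed.\<close>

lemma discrete_range: "d ` U = B \<inter> U"
proof
  show "B \<inter> U \<subseteq> d ` U" using P_range P_id by fastforce
qed (use U in auto)

lemma discrete_kernel: "kernel_on U d = Z \<inter> U"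
  using U by (auto simp: kernel_on_def)

text \<open>Commutation gives \<open>d (P v) = P (d w)\<close>, and \<open>P\<close> fixes
  \<open>d w\<close>. This supplies the orthogonality behind both the discrete Poincare inequality
  and \<open>coexact_error\<close>.\<close>

lemma P_diff_mem_kernel:
  assumes "v \<in> D" "w \<in> U" "d v = d w"
  shows "P v - w \<in> kernel_on U d"
proof -
  have "w \<in> D" "P v \<in> D" using assms U P_mem by auto
  moreover have "d (P v) = d w"
    using assms U commute[OF assms(1)] P_id[of "d w"] by auto
  ultimately show ?thesis
    using assms U P_mem by (auto simp: kernel_on_def subspace_diff d_diff)
qed

text \<open>The Poincare inequality is inherited: compare a discrete \<open>v\<close> with \<open>P y\<close>, where \<open>y\<close> is the
  continuous potential of \<open>d v\<close>.\<close>

sublocale discrete: poincare_complex U d "M * c"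
proof
  show "linear_operator_on U d"
    using U(1,3) d_add d_scale unfolding linear_operator_on_def by blast
  show "d ` U \<subseteq> kernel_on U d"
    using discrete_range discrete_kernel range_sub_ker by blast
  show "closed (kernel_on U d)"
    unfolding discrete_kernel using closed_ker U(2) by (rule closed_Int)
  show "closed (d ` U)"
    unfolding discrete_range using closed_ran U(2) by (rule closed_Int)
  show "0 \<le> M * c" using M_nonneg c_nonneg by simp
  fix v assume v: "v \<in> U" "v \<in> (kernel_on U d)\<^sup>\<bottom>"
  then obtain y where y: "y \<in> D" "y \<in> Z\<^sup>\<bottom>" "d y = d v"
    using potential_exists[of "d v"] U by blast
  have "v \<bullet> (P y - v) = 0"
    using v(2) P_diff_mem_kernel[OF y(1) v(1) y(3)] by (simp add: orthogonal_comp_iff)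
  then have "(norm v)\<^sup>2 = v \<bullet> P y" by (simp add: inner_diff_right power2_norm_eq_inner)
  also have "\<dots> \<le> norm v * norm (P y)" by (rule norm_cauchy_schwarz)
  finally have "norm v \<le> norm (P y)" by (cases "v = 0") (auto simp: power2_eq_square)
  also have "\<dots> \<le> M * (c * norm (d v))"
    using norm_P[of y] mult_left_mono[OF poincare[OF y(1,2)] M_nonneg] y(3) by simp
  finally show "norm v \<le> M * c * norm (d v)" by simp
qed

section \<open>Error estimates\<close>

abbreviation "K \<equiv> solution_op D d"
abbreviation "\<eta> \<equiv> onorm (\<lambda>w. K w - P (K w))"

lemma bounded_linear_K_error: "bounded_linear (\<lambda>w. K w - P (K w))"
  by (rule bounded_linear_sub[OF bounded_linear_solution_op
        bounded_linear_compose[OF bounded_linear_P bounded_linear_solution_op]])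

lemma K_error: "norm (K w - P (K w)) \<le> \<eta> * norm w"
  by (rule onorm[OF bounded_linear_K_error])

lemma \<eta>_nonneg: "\<eta> \<ge> 0"
  by (rule onorm_pos_le[OF bounded_linear_K_error])

text \<open>Both problems have the same data, so \<open>solves_range\<close> yields Galerkin
  orthogonality. By commutation \<open>P (d u)\<close> lies in the discrete range, so it competes
  with the best approximation \<open>d uh\<close>.\<close>

lemma range_error:
  assumes u: "solves D d f u p" and uh: "solves U d f uh ph"
  shows "norm (d u - d uh) \<le> norm (d u - P (d u))"
    and "b \<in> d ` U \<Longrightarrow> (d u - d uh) \<bullet> b = 0"
proof -
  have uD: "u \<in> D" and uhU: "uh \<in> U" using assms by (auto simp: solves_def)
  have orth: "(d u - d uh) \<bullet> b = 0" if "b \<in> d ` U" for b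
    using that U solves_range[OF u] discrete.solves_range[OF uh] by (auto simp: inner_diff_left)
  then show "b \<in> d ` U \<Longrightarrow> (d u - d uh) \<bullet> b = 0" .
  have "d uh - P (d u) \<in> d ` U"
    using uhU P_range[of "d u"] uD discrete.subspace_B by (intro subspace_diff) auto
  then have "(d u - d uh) \<bullet> (d uh - P (d u)) = 0" by (rule orth)
  then have "(norm (d u - d uh))\<^sup>2 = (d u - d uh) \<bullet> (d u - P (d u))"
    by (simp add: power2_norm_eq_inner inner_diff_right)
  also have "\<dots> \<le> norm (d u - d uh) * norm (d u - P (d u))" by (rule norm_cauchy_schwarz)
  finally show "norm (d u - d uh) \<le> norm (d u - P (d u))"
    by (cases "d u = d uh") (auto simp: power2_eq_square)
qed

text \<open>Aubin--Nitsche duality: \<open>K e\<close> is a weak adjoint preimage of \<open>e\<close> in the range of \<open>d\<close>, and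
  \<open>d e\<close> is orthogonal to \<open>P (K e)\<close>.\<close>

lemma duality:
  assumes e: "e \<in> D" "e \<in> Z\<^sup>\<bottom>" and orth: "\<And>b. b \<in> d ` U \<Longrightarrow> d e \<bullet> b = 0"
  shows "norm e \<le> \<eta> * norm (d e)"
proof -
  obtain z where z: "z \<in> B" "\<forall>v\<in>D. d v \<bullet> z = v \<bullet> e"
    using weak_adjoint_preimage[OF e(2)] by blast
  have Ke: "K e = z" using solution_op_eq[OF solves_adjoint_preimage[OF z(1)]] z(2) by blast
  have "(norm e)\<^sup>2 = d e \<bullet> (z - P z)"
    using z e orth[OF P_range[OF z(1)]] by (simp add: power2_norm_eq_inner inner_diff_right)
  also have "\<dots> \<le> norm (d e) * norm (z - P z)" by (rule norm_cauchy_schwarz)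
  also have "\<dots> \<le> norm (d e) * (\<eta> * norm e)"
    using K_error[of e] by (intro mult_left_mono) (auto simp: Ke)
  finally show ?thesis
    using \<eta>_nonneg by (cases "e = 0") (auto simp: power2_eq_square mult.commute)
qed

lemma coexact_error:
  assumes u: "solves D d f u p" and uh: "solves U d f uh ph"
  shows "norm (orth_proj (adjoint_range UNIV D d) u - orth_proj (adjoint_range U U d) uh)
    \<le> 2 * (1 + M) * (best_error U (orth_proj (adjoint_range UNIV D d) u) + \<eta> * best_error U (d u))"
proof -
  have uD: "u \<in> D" and uhU: "uh \<in> U" using assms by (auto simp: solves_def)
  define y where "y = orth_proj (adjoint_range UNIV D d) u"
  define w where "w = orth_proj (adjoint_range U U d) uh"
  have "y = u - orth_proj Z u"
    unfolding y_def using dense uD by (intro orth_proj_adjoint_range) auto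
  then have y: "y \<in> D" "d y = d u" "y \<in> Z\<^sup>\<bottom>" using proj_Z_compl[OF uD] by auto
  have "w = uh - orth_proj (kernel_on U d) uh"
    unfolding w_def using U uhU closure_subset by (intro discrete.orth_proj_adjoint_range) auto
  then have w: "w \<in> U" "d w = d uh" "w \<in> (kernel_on U d)\<^sup>\<bottom>"
    using discrete.proj_Z_compl[OF uhU] by auto
  define x where "x = w - orth_proj Z w"
  have x: "x \<in> D" "d x = d w" "x \<in> Z\<^sup>\<bottom>"
    unfolding x_def using proj_Z_compl[of w] w U by auto
  define g where "g = norm (d u - d uh)"
  have yx: "y - x \<in> D" "y - x \<in> Z\<^sup>\<bottom>" "d (y - x) = d u - d uh"
    using x y w subspace_D by (auto simp: subspace_diff d_diff orthogonal_comp_iff inner_diff_left)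
  have 1: "norm (y - x) \<le> \<eta> * g"
    using duality[OF yx(1,2)] range_error(2)[OF u uh] yx(3) by (simp add: g_def)
  \<comment> \<open>Because \<open>K\<close> inverts \<open>d\<close> here, the projection error of
    \<open>y - x\<close> is an error of \<open>K\<close> and is controlled by
    \<open>\<eta>\<close>.\<close>
  have "K (d (y - x)) = y - x"
    by (rule solution_op_eq[OF solves_potential[OF yx(1,2)]])
  then have 2: "norm ((y - x) - P (y - x)) \<le> \<eta> * g"
    using K_error[of "d (y - x)"] yx(3) by (simp add: g_def)
  have "(w - x) \<bullet> (w - P x) = 0"
  proof -
    \<comment> \<open>The discrete kernel is contained in \<open>Z\<close>, so its element
      \<open>P x - w\<close> is orthogonal to \<open>x\<close> as well as to
      \<open>w\<close>.\<close>
    have "P x - w \<in> kernel_on U d" by (rule P_diff_mem_kernel[OF x(1) w(1) x(2)])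
    then have "w \<bullet> (P x - w) = 0" "x \<bullet> (P x - w) = 0"
      using w(3) x(3) discrete_kernel by (auto simp: orthogonal_comp_iff)
    then show ?thesis by (simp add: inner_diff)
  qed
  then have "(norm (w - x))\<^sup>2 = (w - x) \<bullet> (P x - x)"
    by (simp add: power2_norm_eq_inner inner_diff_right)
  also have "\<dots> \<le> norm (w - x) * norm (P x - x)" by (rule norm_cauchy_schwarz)
  finally have "norm (w - x) \<le> norm (x - P x)"
    by (cases "w = x") (auto simp: power2_eq_square norm_minus_commute)
  \<comment> \<open>This trades the \<open>h\<close>-dependent \<open>x\<close> for
    \<open>y\<close>, whose projection error is a best approximation error of the exact
    solution.\<close>
  also have "x - P x = (y - P y) - ((y - x) - P (y - x))"
    by (simp add: linear_diff bounded_linear.linear[OF bounded_linear_P])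
  also have "norm \<dots> \<le> norm (y - P y) + \<eta> * g"
    using norm_triangle_ineq4[of "y - P y" "(y - x) - P (y - x)"] 2 by linarith
  finally have "norm (y - w) \<le> norm (y - P y) + 2 * (\<eta> * g)"
    using 1 norm_triangle_ineq4[of "y - x" "w - x"] by simp
  moreover have "g \<le> (1 + M) * best_error U (d u)"
    using range_error(1)[OF u uh] projection_error_le_best_error[OF proj U(1) M, of "d u"]
    by (simp add: g_def)
  then have "\<eta> * g \<le> \<eta> * ((1 + M) * best_error U (d u))"
    using \<eta>_nonneg by (rule mult_left_mono)
  moreover have "norm (y - P y) \<le> (1 + M) * best_error U y"
    by (rule projection_error_le_best_error[OF proj U(1) M])
  \<comment> \<open>Nonnegativity allows the coefficient of this term to be doubled; the other term
    already carries two contributions \<open>\<eta> * g\<close>.\<close>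
  moreover have "0 \<le> (1 + M) * best_error U y"
    using norm_ge_zero order_trans calculation(3) by blast
  ultimately have "norm (y - w) \<le> 2 * (1 + M) * (best_error U y + \<eta> * best_error U (d u))"
    by (simp add: algebra_simps)
  then show ?thesis by (simp add: y_def w_def)
qed

end

theorem theorem3p8:
  fixes V :: "'a::{real_inner, complete_space} set"
    and d :: "'a \<Rightarrow> 'a"
    and I :: "'h set"
    and Vh :: "'h \<Rightarrow> 'a set"
    and \<pi> :: "'h \<Rightarrow> 'a \<Rightarrow> 'a"
  assumes "diffuse_Fredholm_nilpotent V d"
    and "\<And>h. h \<in> I \<Longrightarrow> subspace (Vh h) \<and> closed (Vh h) \<and> Vh h \<subseteq> V"
    and "\<And>h. h \<in> I \<Longrightarrow> d ` Vh h \<subseteq> Vh h"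
    and "\<And>h. h \<in> I \<Longrightarrow> bounded_projection_onto (Vh h) (\<pi> h)"
    and "\<exists>M. \<forall>h\<in>I. onorm (\<pi> h) \<le> M"
    and "\<And>h v. h \<in> I \<Longrightarrow> v \<in> V \<Longrightarrow> \<pi> h (d v) = d (\<pi> h v)"
  shows "\<exists>C>0. \<forall>h\<in>I. \<forall>f u p uh ph.
    solves V d f u p \<longrightarrow> solves (Vh h) d f uh ph \<longrightarrow>
    (let Bstar = adjoint_range UNIV V d;
         Bhstar = adjoint_range (Vh h) (Vh h) d;
         \<eta> = onorm (\<lambda>w. solution_op V d w - \<pi> h (solution_op V d w));
         E = best_error (Vh h)
     in norm (orth_proj Bstar u - orth_proj Bhstar uh)
          \<le> C * (E (orth_proj Bstar u) + \<eta> * E (d u)))"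
proof -
  obtain c where c: "poincare_complex V d c"
    using diffuse_Fredholm_nilpotent_poincare_complex[OF assms(1)] .
  obtain M0 where M0: "\<forall>h\<in>I. onorm (\<pi> h) \<le> M0" using assms(5) by blast
  \<comment> \<open>For empty \<open>I\<close> the bound \<open>M0\<close> may be negative; the
    maximum keeps \<open>2 * (1 + M)\<close> positive.\<close>
  define M where "M = max M0 0"
  have dense: "closure V = UNIV"
    using assms(1)
    by (simp add: diffuse_Fredholm_nilpotent_def nilpotent_operator_def densely_defined_def)
  have com: "commuting_projection V d c (Vh h) (\<pi> h) M" if "h \<in> I" for h
    using that c dense assms M0
    by (intro commuting_projection.intro commuting_projection_axioms.intro) (auto simp: M_def le_max_iff_disj)
  show ?thesis
    unfolding Let_def
    using commuting_projection.coexact_error[OF com]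
    by (intro exI[of _ "2 * (1 + M)"]) (auto simp: M_def)
qed

end
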